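(* Let $\mathbb{X},\mathbb{Y}$ be finite-dimensional real inner product spaces, let $f\colon\mathbb{X}\to\mathbb{X}$ be differentiable, let $\Phi\colon\mathbb{X}\to\mathbb{Y}$ be twice differentiable, and let $\Theta\subset\mathbb{Y}$ be closed. Put $\Psi(x,\lambda):=f(x)+\nabla\Phi(x)^*\lambda$. Let $\bar x\in\mathbb{X}$ with $\Phi(\bar x)\in\Theta$ satisfy the stationarity condition $0\in f(\bar x)+\partial(\delta_\Theta\circ\Phi)(\bar x)$, let $\Theta$ be (normally) regular at $\Phi(\bar x)$, and let $\bar\lambda\in\Lambda(\bar x):=\{\lambda\in\mathbb{Y}\mid\Psi(\bar x,\lambda)=0,\ \lambda\in N_\Theta(\Phi(\bar x))\}$. Let $M_{\bar x}\colon\mathbb{X}\times\mathbb{Y}\rightrightarrows\mathbb{Y}$ be the Lagrange multiplier mapping $$M_{\bar x}(v,w):=\{\lambda\in\mathbb{Y}\mid v=\Psi(\bar x,\lambda),\ \lambda\in N_\Theta(\Phi(\bar x)+w)\}.$$ Then the following assertions are equivalent: (i) The Lagrange multiplier $\bar\lambda$ is unique (i.e. $\Lambda(\bar x)=\{\bar\lambda\}$) and there exist $\ell\ge0$ and $\varepsilon>0$ such that $$d\big(\lambda;\Lambda(\bar x)\big)\le\ell\Big(\|\Psi(\bar x,\lambda)\|+d\big(\Phi(\bar x);N_\Theta^{-1}(\lambda)\big)\Big)\quad\text{for all }\lambda\in\mathbb{B}_\varepsilon(\bar\lambda).$$ (ii) The Lagrange multiplier $\bar\lambda$ is unique and the mapping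 $M_{\bar x}$ is calm at $((0,0),\bar\lambda)$. (iii) The mapping $M_{\bar x}$ is isolatedly calm at $((0,0),\bar\lambda)$. (iv) The dual qualification condition holds: $$DN_\Theta(\Phi(\bar x),\bar\lambda)(0)\cap\ker\nabla\Phi(\bar x)^*=\{0\}.$$
   Context: $\mathbb{B}$ is the closed unit ball of the space in question, $\mathbb{B}_r(x)=x+r\mathbb{B}$; $d(x;\Omega)$ is the distance from $x$ to $\Omega$ ($=\infty$ if $\Omega=\emptyset$). For a linear operator, $^*$ is the adjoint; for a set $\Omega$, $\Omega^*=\{v\mid\langle v,x\rangle\le 0\ \forall x\in\Omega\}$ is the polar. Tangent cone: $T_\Omega(\bar x)=\{w\mid\exists\,t_k\downarrow0,\ w_k\to w,\ \bar x+t_kw_k\in\Omega\}$ for $\bar x\in\Omega$. Regular normal cone: $\widehat N_\Omega(\bar x)=T_\Omega(\bar x)^*$. (Limiting) normal cone: $N_\Omega(\bar x)=\{v\mid\exists\,x_k\to\bar x,\ x_k\in\Omega,\ v_k\to v,\ v_k\in\widehat N_\Omega(x_k)\}$ for $\bar x\in\Omega$, and $N_\Omega(x)=\emptyset$ for $x\notin\Omega$. $\Omega$ is (normally) regular at $\bar x\in\Omega$ if $\widehat N_\Omega(\bar x)=N_\Omega(\bar x)$. $N_\Theta^{-1}(\lambda)=\{z\mid\lambda\in N_\Theta(z)\}$. $\delta_\Theta$ is the indicator function of $\Theta$ ($0$ on $\Theta$, $\infty$ elsewhere). The (limiting) subdifferential of $g\colon\mathbb{X}\to(-\infty,\infty]$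 at $\bar x$ with $g(\bar x)<\infty$ is $\partial g(\bar x)=\{v\mid(v,-1)\in N_{\mathrm{epi}\,g}(\bar x,g(\bar x))\}$; thus $\partial(\delta_\Theta\circ\Phi)(\bar x)=N_{\Phi^{-1}(\Theta)}(\bar x)$. Graphical derivative of $F\colon\mathbb{X}\rightrightarrows\mathbb{Y}$ at $(\bar x,\bar y)\in\mathrm{gph}\,F$: $DF(\bar x,\bar y)(u)=\{v\mid(u,v)\in T_{\mathrm{gph}\,F}(\bar x,\bar y)\}$. $F$ is calm at $(\bar p,\bar q)\in\mathrm{gph}\,F$ if there are $\ell\ge0$ and neighborhoods $U$ of $\bar p$, $V$ of $\bar q$ with $F(p)\cap V\subset F(\bar p)+\ell\|p-\bar p\|\mathbb{B}$ for all $p\in U$; it is isolatedly calm there if $F(p)\cap V\subset\{\bar q\}+\ell\|p-\bar p\|\mathbb{B}$ for all $p\in U$. *)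

theory Defs
  imports "HOL-Analysis.Analysis"
begin

definition polar :: "'a::real_inner set \<Rightarrow> 'a set" where
  "polar S = {v. \<forall>x\<in>S. v \<bullet> x \<le> 0}"

definition tangent_cone :: "'a::real_inner set \<Rightarrow> 'a \<Rightarrow> 'a set" where
  "tangent_cone S x = {w. \<exists>(t :: nat \<Rightarrow> real) (u :: nat \<Rightarrow> 'a).
     (\<forall>k. t k > 0) \<and> t \<longlonglongrightarrow> 0 \<and> u \<longlonglongrightarrow> w \<and> (\<forall>k. x + t k *\<^sub>R u k \<in> S)}"

text \<open>The next set is meaningful for \<open>x \<in> S\<close> only; it is never used at other points.\<close>

definition regular_normal_cone :: "'a::real_inner set \<Rightarrow> 'a \<Rightarrow> 'a set" where
  "regular_normal_cone S x = polar (tangent_cone S x)"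

definition normal_cone :: "'a::real_inner set \<Rightarrow> 'a \<Rightarrow> 'a set" where
  "normal_cone S x = (if x \<in> S then
     {v. \<exists>(y :: nat \<Rightarrow> 'a) (u :: nat \<Rightarrow> 'a).
        y \<longlonglongrightarrow> x \<and> (\<forall>k. y k \<in> S) \<and> u \<longlonglongrightarrow> v \<and> (\<forall>k. u k \<in> regular_normal_cone S (y k))}
   else {})"

definition normally_regular :: "'a::real_inner set \<Rightarrow> 'a \<Rightarrow> bool" where
  "normally_regular S x \<longleftrightarrow> x \<in> S \<and> regular_normal_cone S x = normal_cone S x"

definition inverse_normal_cone :: "'a::real_inner set \<Rightarrow> 'a \<Rightarrow> 'a set" where
  "inverse_normal_cone S l = {z. l \<in> normal_cone S z}"

definition indicator_fun :: "'a set \<Rightarrow> 'a \<Rightarrow> ereal" where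
  "indicator_fun S x = (if x \<in> S then 0 else \<infinity>)"

definition epi :: "('a \<Rightarrow> ereal) \<Rightarrow> ('a \<times> real) set" where
  "epi g = {(x, r). g x \<le> ereal r}"

definition subdifferential :: "('a::real_inner \<Rightarrow> ereal) \<Rightarrow> 'a \<Rightarrow> 'a set" where
  "subdifferential g x =
     {v. \<bar>g x\<bar> \<noteq> \<infinity> \<and> (v, -1) \<in> normal_cone (epi g) (x, real_of_ereal (g x))}"

definition gph :: "('a \<Rightarrow> 'b set) \<Rightarrow> ('a \<times> 'b) set" where
  "gph F = {(x, y). y \<in> F x}"

definition graphical_derivative ::
    "('a::real_inner \<Rightarrow> 'b::real_inner set) \<Rightarrow> 'a \<Rightarrow> 'b \<Rightarrow> 'a \<Rightarrow> 'b set" where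
  "graphical_derivative F x y u = {v. (u, v) \<in> tangent_cone (gph F) (x, y)}"

definition calm_at ::
    "('a::real_normed_vector \<Rightarrow> 'b::real_normed_vector set) \<Rightarrow> 'a \<Rightarrow> 'b \<Rightarrow> bool" where
  "calm_at F p0 q0 \<longleftrightarrow> (p0, q0) \<in> gph F \<and>
     (\<exists>l\<ge>0. \<exists>U V. open U \<and> p0 \<in> U \<and> open V \<and> q0 \<in> V \<and>
        (\<forall>p\<in>U. F p \<inter> V \<subseteq> {q + e | q e. q \<in> F p0 \<and> e \<in> cball 0 (l * norm (p - p0))}))"

definition isolatedly_calm_at ::
    "('a::real_normed_vector \<Rightarrow> 'b::real_normed_vector set) \<Rightarrow> 'a \<Rightarrow> 'b \<Rightarrow> bool" where
  "isolatedly_calm_at F p0 q0 \<longleftrightarrow> (p0, q0) \<in> gph F \<and>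
     (\<exists>l\<ge>0. \<exists>U V. open U \<and> p0 \<in> U \<and> open V \<and> q0 \<in> V \<and>
        (\<forall>p\<in>U. F p \<inter> V \<subseteq> {q0 + e | e. e \<in> cball 0 (l * norm (p - p0))}))"

text \<open>Unlike \<open>infdist\<close>, which is 0 for the empty set, this distance is infinite there.
  In products \<open>c * edist_set x S\<close> with real \<open>c \<ge> 0\<close>, \<open>ereal\<close> has \<open>0 * \<infinity> = 0\<close>; this does not affect
  the existence of a constant \<open>c\<close> in an estimate, since \<open>c = 0\<close> can then be replaced by \<open>c = 1\<close>.\<close>

definition edist_set :: "'a::metric_space \<Rightarrow> 'a set \<Rightarrow> ereal" where
  "edist_set x S = (if S = {} then \<infinity> else ereal (infdist x S))"

definition twice_differentiable :: "('a::real_normed_vector \<Rightarrow> 'b::real_normed_vector) \<Rightarrow> bool" where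
  "twice_differentiable g \<longleftrightarrow> (\<exists>D :: 'a \<Rightarrow> 'a \<Rightarrow>\<^sub>L 'b.
     (\<forall>x. (g has_derivative blinfun_apply (D x)) (at x)) \<and> (\<forall>x. D differentiable (at x)))"

definition adj_deriv :: "('a::euclidean_space \<Rightarrow> 'b::euclidean_space) \<Rightarrow> 'a \<Rightarrow> 'b \<Rightarrow> 'a" where
  "adj_deriv Phi x = adjoint (frechet_derivative Phi (at x))"

definition Psi :: "('a::euclidean_space \<Rightarrow> 'a) \<Rightarrow> ('a \<Rightarrow> 'b::euclidean_space) \<Rightarrow> 'a \<Rightarrow> 'b \<Rightarrow> 'a" where
  "Psi f Phi x l = f x + adj_deriv Phi x l"

definition multipliers ::
    "('a::euclidean_space \<Rightarrow> 'a) \<Rightarrow> ('a \<Rightarrow> 'b::euclidean_space) \<Rightarrow> 'b set \<Rightarrow> 'a \<Rightarrow> 'b set" where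
  "multipliers f Phi Theta x = {l. Psi f Phi x l = 0 \<and> l \<in> normal_cone Theta (Phi x)}"

definition multiplier_map ::
    "('a::euclidean_space \<Rightarrow> 'a) \<Rightarrow> ('a \<Rightarrow> 'b::euclidean_space) \<Rightarrow> 'b set \<Rightarrow> 'a \<Rightarrow> 'a \<times> 'b \<Rightarrow> 'b set" where
  "multiplier_map f Phi Theta x = (\<lambda>(v, w). {l. v = Psi f Phi x l \<and> l \<in> normal_cone Theta (Phi x + w)})"

end

theory Submission
  imports Defs
begin

text \<open>Isolated calmness of a set-valued mapping with finite-dimensional values is equivalent to
  triviality of its graphical derivative at \<open>0\<close> (a normalized violating sequence accumulates at a
  nonzero tangent direction). The graphical derivative of the multiplier mapping is computed
  exactly, since \<open>\<Psi>\<close> is affine in the multiplier; at the origin it is the set in the dual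
  qualification condition. Regularity of \<open>\<Theta>\<close> makes the multiplier set convex, so the local
  uniqueness contained in isolated calmness is global. The error bound is isolated calmness
  rewritten, with points where the distance to \<open>N\<^sub>\<Theta>\<^sup>-\<^sup>1(\<lambda>)\<close> is not small being trivial.\<close>

lemma convex_polar: "convex (polar S)"
proof (rule convexI)
  fix x y and u v :: real
  assume xy: "x \<in> polar S" "y \<in> polar S" and uv: "0 \<le> u" "0 \<le> v" "u + v = 1"
  have "(u *\<^sub>R x + v *\<^sub>R y) \<bullet> z \<le> 0" if "z \<in> S" for z
  proof -
    have "x \<bullet> z \<le> 0" "y \<bullet> z \<le> 0"
      using xy that by (auto simp: polar_def)
    then have "u * (x \<bullet> z) \<le> 0" "v * (y \<bullet> z) \<le> 0"
      using uv by (simp_all add: mult_nonneg_nonpos)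
    then show ?thesis
      by (simp add: inner_add_left)
  qed
  then show "u *\<^sub>R x + v *\<^sub>R y \<in> polar S"
    by (simp add: polar_def)
qed

section \<open>Isolated calmness and singleton values\<close>

text \<open>The inclusion in the definition passes to smaller neighborhoods, so both can be shrunk
  to balls of one common radius. This pointwise estimate is the form in which isolated calmness is
  used and negated below.\<close>

lemma isolatedly_calm_at_iff:
  "isolatedly_calm_at F p0 q0 \<longleftrightarrow> (p0, q0) \<in> gph F \<and>
     (\<exists>l\<ge>0. \<exists>\<epsilon>>0. \<forall>p\<in>ball p0 \<epsilon>. \<forall>q\<in>F p \<inter> ball q0 \<epsilon>. norm (q - q0) \<le> l * norm (p - p0))"
  (is "_ \<longleftrightarrow> _ \<and> ?R")
proof -
  have ball: "{q0 + e | e. e \<in> cball 0 r} = cball q0 r" for r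
  proof (intro set_eqI iffI)
    fix q assume "q \<in> cball q0 r"
    then show "q \<in> {q0 + e | e. e \<in> cball 0 r}"
      by (auto simp: dist_norm norm_minus_commute[of q0] intro!: exI[of _ "q - q0"])
  qed (auto simp: dist_norm)
  have "?R" if "isolatedly_calm_at F p0 q0"
  proof -
    from that obtain l U V where l: "l \<ge> 0" "open U" "p0 \<in> U" "open V" "q0 \<in> V"
      and *: "\<And>p. p \<in> U \<Longrightarrow> F p \<inter> V \<subseteq> cball q0 (l * norm (p - p0))"
      unfolding isolatedly_calm_at_def ball by blast
    obtain a b where ab: "a > 0" "ball p0 a \<subseteq> U" "b > 0" "ball q0 b \<subseteq> V"
      using l by (meson openE)
    have "norm (q - q0) \<le> l * norm (p - p0)"
      if p: "p \<in> ball p0 (min a b)" and q: "q \<in> F p \<inter> ball q0 (min a b)" for p q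
    proof -
      have "p \<in> U" "q \<in> F p \<inter> V"
        using p q ab by auto
      with * have "q \<in> cball q0 (l * norm (p - p0))"
        by blast
      then show ?thesis
        by (simp add: dist_norm norm_minus_commute)
    qed
    moreover have "min a b > 0"
      using ab by simp
    ultimately show ?thesis
      using l(1) by blast
  qed
  moreover have "isolatedly_calm_at F p0 q0" if "(p0, q0) \<in> gph F" "?R"
  proof -
    from that(2) obtain l \<epsilon> where l: "l \<ge> 0" "\<epsilon> > 0"
      and *: "\<And>p q. p \<in> ball p0 \<epsilon> \<Longrightarrow> q \<in> F p \<inter> ball q0 \<epsilon> \<Longrightarrow> norm (q - q0) \<le> l * norm (p - p0)"
      by blast
    have "\<forall>p\<in>ball p0 \<epsilon>. F p \<inter> ball q0 \<epsilon> \<subseteq> cball q0 (l * norm (p - p0))"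
    proof (intro ballI subsetI)
      fix p q assume "p \<in> ball p0 \<epsilon>" "q \<in> F p \<inter> ball q0 \<epsilon>"
      from *[OF this] show "q \<in> cball q0 (l * norm (p - p0))"
        by (simp add: dist_norm norm_minus_commute)
    qed
    then show ?thesis
      unfolding isolatedly_calm_at_def ball using that(1) l
      by (intro conjI exI[of _ l] exI[of _ "ball p0 \<epsilon>"] exI[of _ "ball q0 \<epsilon>"]) auto
  qed
  ultimately show ?thesis
    unfolding isolatedly_calm_at_def by blast
qed

text \<open>At \<open>p = p0\<close> the calmness estimate has right-hand side 0, so
  \<open>q0\<close> is an isolated point of \<open>F p0\<close>. In a convex set the segment from
  \<open>q0\<close> to any other point would meet every ball around \<open>q0\<close>.\<close>

lemma isolatedly_calm_at_convex_value:
  assumes "isolatedly_calm_at F p0 q0" and "convex (F p0)"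
  shows "F p0 = {q0}"
proof -
  from assms(1) obtain l \<epsilon> where q0: "q0 \<in> F p0" and "\<epsilon> > 0"
    and calm: "\<And>p q. p \<in> ball p0 \<epsilon> \<Longrightarrow> q \<in> F p \<inter> ball q0 \<epsilon> \<Longrightarrow> norm (q - q0) \<le> l * norm (p - p0)"
    unfolding isolatedly_calm_at_iff gph_def by blast
  have "q = q0" if q: "q \<in> F p0" for q
  proof (rule ccontr)
    assume "q \<noteq> q0"
    then have n: "norm (q - q0) > 0"
      by simp
    \<comment> \<open>The cap at 1 keeps \<open>r\<close> below on the segment; the other term keeps
      it within \<open>\<epsilon> / 2\<close> of \<open>q0\<close>.\<close>
    define s where "s = min 1 (\<epsilon> / (2 * norm (q - q0)))"
    have s: "0 < s" "s \<le> 1"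
      using n \<open>\<epsilon> > 0\<close> by (auto simp: s_def)
    have "s * norm (q - q0) \<le> \<epsilon> / (2 * norm (q - q0)) * norm (q - q0)"
      unfolding s_def by (intro mult_right_mono) auto
    also have "\<dots> = \<epsilon> / 2"
      using n by simp
    finally have small: "s * norm (q - q0) < \<epsilon>"
      using \<open>\<epsilon> > 0\<close> by simp
    define r where "r = (1 - s) *\<^sub>R q0 + s *\<^sub>R q"
    have r: "r - q0 = s *\<^sub>R (q - q0)"
      by (simp add: r_def algebra_simps)
    have "r \<in> F p0"
      unfolding r_def using assms(2) q0 q s by (intro convexD) auto
    moreover have "r \<in> ball q0 \<epsilon>"
      using small s r by (simp add: dist_norm norm_minus_commute[of q0])
    ultimately have "norm (r - q0) \<le> 0"
      using calm[of p0 r] \<open>\<epsilon> > 0\<close> by simp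
    then show False
      using r s \<open>q \<noteq> q0\<close> by (simp add: mult_le_0_iff)
  qed
  with q0 show ?thesis
    by blast
qed

lemma calm_at_iff_isolatedly_calm_at:
  assumes "F p0 = {q0}"
  shows "calm_at F p0 q0 \<longleftrightarrow> isolatedly_calm_at F p0 q0"
  unfolding calm_at_def isolatedly_calm_at_def assms by simp

section \<open>Graphical derivatives and isolated calmness\<close>

lemma zero_in_tangent_cone:
  assumes "x \<in> S"
  shows "0 \<in> tangent_cone S x"
proof -
  have "(\<lambda>k. inverse (real (Suc k))) \<longlonglongrightarrow> 0"
    by (rule LIMSEQ_inverse_real_of_nat)
  then show ?thesis
    unfolding tangent_cone_def using assms
    by (intro CollectI exI[of _ "\<lambda>k. inverse (real (Suc k))"] exI[of _ "\<lambda>_. 0"]) auto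
qed

text \<open>With the elimination rule that follows, this replaces a tangent sequence in the product
  space by two component sequences with common step sizes.\<close>

lemma graphical_derivativeI:
  fixes t :: "nat \<Rightarrow> real"
  assumes "\<And>k. t k > 0" "t \<longlonglongrightarrow> 0" "a \<longlonglongrightarrow> u" "b \<longlonglongrightarrow> v"
    and "\<And>k. y + t k *\<^sub>R b k \<in> F (x + t k *\<^sub>R a k)"
  shows "v \<in> graphical_derivative F x y u"
proof -
  have "(\<lambda>k. (a k, b k)) \<longlonglongrightarrow> (u, v)"
    using assms by (intro tendsto_Pair)
  then show ?thesis
    unfolding graphical_derivative_def tangent_cone_def using assms
    by (intro CollectI exI[of _ t] exI[of _ "\<lambda>k. (a k, b k)"]) (auto simp: gph_def)
qed

lemma graphical_derivativeE:
  assumes "v \<in> graphical_derivative F x y u"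
  obtains t :: "nat \<Rightarrow> real" and a b
  where "\<forall>k. t k > 0" "t \<longlonglongrightarrow> 0" "a \<longlonglongrightarrow> u" "b \<longlonglongrightarrow> v"
    "\<forall>k. y + t k *\<^sub>R b k \<in> F (x + t k *\<^sub>R a k)"
proof -
  from assms obtain t :: "nat \<Rightarrow> real" and w where t: "\<forall>k. t k > 0" "t \<longlonglongrightarrow> 0"
    and w: "w \<longlonglongrightarrow> (u, v)" and mem: "\<forall>k. (x, y) + t k *\<^sub>R w k \<in> gph F"
    unfolding graphical_derivative_def tangent_cone_def by blast
  have "(\<lambda>k. fst (w k)) \<longlonglongrightarrow> u" "(\<lambda>k. snd (w k)) \<longlonglongrightarrow> v"
    using tendsto_fst[OF w] tendsto_snd[OF w] by simp_all
  moreover have "y + t k *\<^sub>R snd (w k) \<in> F (x + t k *\<^sub>R fst (w k))" for k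
    using mem[rule_format, of k] by (simp add: gph_def case_prod_beta)
  ultimately show thesis
    using that t by blast
qed

text \<open>Along a tangent sequence in direction \<open>(0, v)\<close> the calmness estimate,
  divided by the step size, reads \<open>norm (b k) \<le> l * norm (a k)\<close>, and the right-hand
  side tends to 0.\<close>

lemma isolatedly_calm_at_imp_graphical_derivative:
  assumes "isolatedly_calm_at F p0 q0"
  shows "graphical_derivative F p0 q0 0 = {0}"
proof -
  from assms obtain l \<epsilon> where q0: "(p0, q0) \<in> gph F" and "\<epsilon> > 0"
    and calm: "\<And>p q. p \<in> ball p0 \<epsilon> \<Longrightarrow> q \<in> F p \<inter> ball q0 \<epsilon> \<Longrightarrow> norm (q - q0) \<le> l * norm (p - p0)"
    unfolding isolatedly_calm_at_iff by blast
  have "v = 0" if "v \<in> graphical_derivative F p0 q0 0" for v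
  proof -
    from that obtain t :: "nat \<Rightarrow> real" and a b
      where t: "\<forall>k. t k > 0" "t \<longlonglongrightarrow> 0" and ab: "a \<longlonglongrightarrow> 0" "b \<longlonglongrightarrow> v"
        and mem: "\<forall>k. q0 + t k *\<^sub>R b k \<in> F (p0 + t k *\<^sub>R a k)"
      by (rule graphical_derivativeE)
    have "(\<lambda>k. p0 + t k *\<^sub>R a k) \<longlonglongrightarrow> p0 + 0 *\<^sub>R 0" "(\<lambda>k. q0 + t k *\<^sub>R b k) \<longlonglongrightarrow> q0 + 0 *\<^sub>R v"
      by (intro tendsto_intros t ab)+
    then have "(\<lambda>k. p0 + t k *\<^sub>R a k) \<longlonglongrightarrow> p0" "(\<lambda>k. q0 + t k *\<^sub>R b k) \<longlonglongrightarrow> q0"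
      by simp_all
    then have "\<forall>\<^sub>F k in sequentially. p0 + t k *\<^sub>R a k \<in> ball p0 \<epsilon>"
      "\<forall>\<^sub>F k in sequentially. q0 + t k *\<^sub>R b k \<in> ball q0 \<epsilon>"
      by (simp_all only: topological_tendstoD open_ball centre_in_ball \<open>\<epsilon> > 0\<close>)
    then have "\<forall>\<^sub>F k in sequentially. norm (b k) \<le> l * norm (a k)"
    proof eventually_elim
      case (elim k)
      then have "t k * norm (b k) \<le> t k * (l * norm (a k))"
        using calm[of "p0 + t k *\<^sub>R a k" "q0 + t k *\<^sub>R b k"] mem[rule_format, of k] t(1)[rule_format, of k]
        by (simp add: mult.left_commute)
      then show ?case
        using t(1)[rule_format, of k] by simp
    qed
    moreover have "(\<lambda>k. l * norm (a k)) \<longlonglongrightarrow> l * norm (0 :: 'a)"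
      by (intro tendsto_intros ab)
    ultimately have "norm v \<le> l * norm (0 :: 'a)"
      using tendsto_norm[OF ab(2)] by (intro tendsto_le[OF sequentially_bot])
    then show ?thesis
      by simp
  qed
  moreover have "0 \<in> graphical_derivative F p0 q0 0"
    using zero_in_tangent_cone[OF q0] by (simp add: graphical_derivative_def zero_prod_def)
  ultimately show ?thesis
    by blast
qed

text \<open>Pairs violating calmness with ever larger moduli move much further in \<open>q\<close>
  than in \<open>p\<close>. After normalization by the displacement of \<open>q\<close>, the
  \<open>p\<close> components vanish, while the \<open>q\<close> components lie on a compact unit
  sphere and accumulate at a nonzero element of the derivative at 0.\<close>

lemma graphical_derivative_imp_isolatedly_calm_at:
  fixes F :: "'a::real_inner \<Rightarrow> 'b::euclidean_space set"
  assumes mem: "(p0, q0) \<in> gph F" and D: "graphical_derivative F p0 q0 0 \<subseteq> {0}"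
  shows "isolatedly_calm_at F p0 q0"
proof (rule ccontr)
  assume "\<not> isolatedly_calm_at F p0 q0"
  then have not_calm: "\<exists>p\<in>ball p0 \<epsilon>. \<exists>q\<in>F p \<inter> ball q0 \<epsilon>. l * norm (p - p0) < norm (q - q0)"
    if "l \<ge> 0" "\<epsilon> > 0" for l \<epsilon>
    using that mem unfolding isolatedly_calm_at_iff by (meson not_less)
  \<comment> \<open>Coupling modulus and radius through \<open>k\<close> gives one sequence that
    both converges to \<open>(p0, q0)\<close> and has a displacement in \<open>p\<close> negligible
    against that in \<open>q\<close>.\<close>
  have "\<exists>p q. p \<in> ball p0 (inverse (real (Suc k))) \<and> q \<in> F p \<inter> ball q0 (inverse (real (Suc k))) \<and>
    real (Suc k) * norm (p - p0) < norm (q - q0)" for k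
    using not_calm[of "real (Suc k)" "inverse (real (Suc k))"] by fastforce
  then obtain p q where p: "\<And>k. p k \<in> ball p0 (inverse (real (Suc k)))"
    and q: "\<And>k. q k \<in> F (p k)" "\<And>k. q k \<in> ball q0 (inverse (real (Suc k)))"
    and less: "\<And>k. real (Suc k) * norm (p k - p0) < norm (q k - q0)"
    by (metis IntD1 IntD2)
  define t where "t k = norm (q k - q0)" for k
  define a where "a k = (p k - p0) /\<^sub>R t k" for k
  define b where "b k = (q k - q0) /\<^sub>R t k" for k
  \<comment> \<open>The violation is strict, so \<open>q k\<close> differs from \<open>q0\<close>
    and the divisions by \<open>t k\<close> are genuine.\<close>
  have t: "t k > 0" for k
    using less[of k] unfolding t_def by (meson le_less_trans mult_nonneg_nonneg norm_ge_zero of_nat_0_le_iff)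
  have t_lim: "t \<longlonglongrightarrow> 0"
  proof (rule Lim_null_comparison[OF always_eventually LIMSEQ_inverse_real_of_nat], intro allI)
    fix k show "norm (t k) \<le> inverse (real (Suc k))"
      using q(2)[of k] by (simp add: t_def dist_norm norm_minus_commute)
  qed
  have a_lim: "a \<longlonglongrightarrow> 0"
  proof (rule Lim_null_comparison[OF always_eventually LIMSEQ_inverse_real_of_nat], intro allI)
    fix k
    have "norm (p k - p0) \<le> inverse (real (Suc k)) * t k"
      using less[of k] by (simp add: t_def field_simps)
    moreover have "norm (a k) = norm (p k - p0) / t k"
      using t[of k] by (simp add: a_def divide_inverse mult.commute)
    ultimately show "norm (a k) \<le> inverse (real (Suc k))"
      using t[of k] by (simp only: pos_divide_le_eq)
  qed
  \<comment> \<open>Only \<open>b\<close> requires a subsequence; \<open>t\<close> and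
    \<open>a\<close> already converge and keep their limits along it.\<close>
  have "b k \<in> sphere 0 1" for k
    using t[of k] by (simp add: b_def t_def)
  then obtain v r where v: "v \<in> sphere 0 1" "strict_mono r" "(b \<circ> r) \<longlonglongrightarrow> v"
    using compact_sphere[of 0 1] unfolding compact_def by metis
  have "q0 + t k *\<^sub>R b k \<in> F (p0 + t k *\<^sub>R a k)" for k
    using q(1)[of k] t[of k] by (simp add: a_def b_def)
  then have "v \<in> graphical_derivative F p0 q0 0"
    using t v LIMSEQ_subseq_LIMSEQ[OF t_lim v(2)] LIMSEQ_subseq_LIMSEQ[OF a_lim v(2)]
    by (intro graphical_derivativeI[of "t \<circ> r" "a \<circ> r" _ "b \<circ> r"]) auto
  then show False
    using D v(1) by auto
qed

section \<open>The multiplier set and the derivative of the multiplier mapping\<close>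

lemma multiplier_map_zero: "multiplier_map f Phi Theta x (0, 0) = multipliers f Phi Theta x"
  by (auto simp: multiplier_map_def multipliers_def)

text \<open>The limiting normal cone can fail to be convex, but regularity identifies it at
  \<open>Phi x\<close> with a polar cone. The stationarity equation contributes the preimage of a
  point under a linear map.\<close>

lemma convex_multipliers:
  assumes "linear (adj_deriv Phi x)" and "normally_regular Theta (Phi x)"
  shows "convex (multipliers f Phi Theta x)"
proof -
  have "multipliers f Phi Theta x =
    adj_deriv Phi x -` {- f x} \<inter> polar (tangent_cone Theta (Phi x))"
    using assms(2)
    by (auto simp: multipliers_def Psi_def normally_regular_def regular_normal_cone_def
        eq_neg_iff_add_eq_0 add.commute)
  then show ?thesis
    using assms(1) by (simp add: convex_Int convex_linear_vimage convex_polar)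
qed

text \<open>The parameter \<open>v\<close> is determined by the multiplier, so a tangent sequence
  for the normal cone mapping extends in exactly one way to one for the multiplier mapping.
  Continuity of the adjoint supplies the limit in \<open>v\<close>.\<close>

lemma graphical_derivative_multiplier_map:
  fixes Phi :: "'a::euclidean_space \<Rightarrow> 'b::euclidean_space"
  assumes lin: "linear (adj_deriv Phi x)" and "Psi f Phi x l = 0"
  shows "graphical_derivative (multiplier_map f Phi Theta x) (0, 0) l (v, w) =
    graphical_derivative (normal_cone Theta) (Phi x) l w \<inter> {\<eta>. adj_deriv Phi x \<eta> = v}"
proof -
  \<comment> \<open>Since \<open>Psi\<close> vanishes at \<open>l\<close>, it is linear in the
    displacement from \<open>l\<close>.\<close>
  have Psi: "Psi f Phi x (l + s *\<^sub>R \<eta>) = s *\<^sub>R adj_deriv Phi x \<eta>" for s \<eta>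
    using assms by (simp add: Psi_def linear_add linear_scale add.assoc[symmetric])
  have cont: "(\<lambda>k. adj_deriv Phi x (b k)) \<longlonglongrightarrow> adj_deriv Phi x \<eta>" if "b \<longlonglongrightarrow> \<eta>" for b \<eta>
    using lin that by (simp only: linear_conv_bounded_linear bounded_linear.tendsto)
  show ?thesis
  proof (intro set_eqI iffI)
    fix \<eta> assume "\<eta> \<in> graphical_derivative (multiplier_map f Phi Theta x) (0, 0) l (v, w)"
    then obtain t :: "nat \<Rightarrow> real" and a b
      where t: "\<forall>k. t k > 0" "t \<longlonglongrightarrow> 0" and ab: "a \<longlonglongrightarrow> (v, w)" "b \<longlonglongrightarrow> \<eta>"
        and mem: "\<forall>k. l + t k *\<^sub>R b k \<in> multiplier_map f Phi Theta x ((0, 0) + t k *\<^sub>R a k)"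
      by (rule graphical_derivativeE)
    have mem': "fst (t k *\<^sub>R a k) = t k *\<^sub>R adj_deriv Phi x (b k)"
      "l + t k *\<^sub>R b k \<in> normal_cone Theta (Phi x + t k *\<^sub>R snd (a k))" for k
      using mem[rule_format, of k] by (auto simp: multiplier_map_def case_prod_beta Psi)
    \<comment> \<open>Cancelling the positive step size gives this identity for every
      \<open>k\<close>, not only in the limit.\<close>
    have "fst (a k) = adj_deriv Phi x (b k)" for k
      using mem'(1)[of k] t(1)[rule_format, of k] by simp
    then have "adj_deriv Phi x \<eta> = v"
      using LIMSEQ_unique[OF cont[OF ab(2)]] tendsto_fst[OF ab(1)] by simp
    moreover have "\<eta> \<in> graphical_derivative (normal_cone Theta) (Phi x) l w"
      using t ab(2) mem'(2) tendsto_snd[OF ab(1)]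
      by (intro graphical_derivativeI[of t "\<lambda>k. snd (a k)" _ b]) auto
    ultimately show "\<eta> \<in> graphical_derivative (normal_cone Theta) (Phi x) l w \<inter>
      {\<eta>. adj_deriv Phi x \<eta> = v}"
      by simp
  next
    fix \<eta> assume \<eta>: "\<eta> \<in> graphical_derivative (normal_cone Theta) (Phi x) l w \<inter>
      {\<eta>. adj_deriv Phi x \<eta> = v}"
    from IntD1[OF this] obtain t :: "nat \<Rightarrow> real" and a b
      where t: "\<forall>k. t k > 0" "t \<longlonglongrightarrow> 0" and ab: "a \<longlonglongrightarrow> w" "b \<longlonglongrightarrow> \<eta>"
        and mem: "\<forall>k. l + t k *\<^sub>R b k \<in> normal_cone Theta (Phi x + t k *\<^sub>R a k)"
      by (rule graphical_derivativeE)
    \<comment> \<open>The first component is chosen so that the equation for \<open>v\<close> holds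
      exactly along the sequence.\<close>
    have "(\<lambda>k. (adj_deriv Phi x (b k), a k)) \<longlonglongrightarrow> (v, w)"
      using cont[OF ab(2)] ab(1) \<eta> by (auto intro: tendsto_Pair)
    then show "\<eta> \<in> graphical_derivative (multiplier_map f Phi Theta x) (0, 0) l (v, w)"
      using t ab(2) mem
      by (intro graphical_derivativeI[of t "\<lambda>k. (adj_deriv Phi x (b k), a k)" _ b])
        (auto simp: multiplier_map_def Psi)
  qed
qed

section \<open>The error bound\<close>

text \<open>If \<open>l\<close> is a value at \<open>(v, w)\<close>, then \<open>Phi x + w\<close>
  lies in the inverse normal cone of \<open>l\<close>, so the distance in the bound is at most
  \<open>norm w\<close>, and the residual \<open>Psi\<close> equals \<open>v\<close>.\<close>

lemma error_bound_imp_isolatedly_calm: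
  assumes M: "l0 \<in> multipliers f Phi Theta x" and "c \<ge> 0" "\<epsilon> > 0"
    and bound: "\<And>l. l \<in> cball l0 \<epsilon> \<Longrightarrow>
      ereal (norm (l - l0)) \<le> ereal c * (ereal (norm (Psi f Phi x l))
        + edist_set (Phi x) (inverse_normal_cone Theta l))"
  shows "isolatedly_calm_at (multiplier_map f Phi Theta x) (0, 0) l0"
proof -
  have "norm (l - l0) \<le> 2 * c * norm (p - (0, 0))"
    if l: "l \<in> multiplier_map f Phi Theta x p \<inter> ball l0 \<epsilon>" for p l
  proof -
    obtain v w where p: "p = (v, w)"
      by fastforce
    have v: "v = Psi f Phi x l" and w: "Phi x + w \<in> inverse_normal_cone Theta l"
      using l by (auto simp: p multiplier_map_def inverse_normal_cone_def)
    have "infdist (Phi x) (inverse_normal_cone Theta l) \<le> norm w"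
      using infdist_le[OF w, of "Phi x"] by (simp add: dist_norm)
    \<comment> \<open>The inverse normal cone contains \<open>Phi x + w\<close>, so the extended
      distance is finite and the bound becomes a real inequality.\<close>
    moreover have "norm (l - l0) \<le> c * (norm v + infdist (Phi x) (inverse_normal_cone Theta l))"
      using bound[of l] l w by (auto simp: edist_set_def v split: if_splits)
    \<comment> \<open>Both \<open>norm v\<close> and \<open>norm w\<close> are at most
      \<open>norm p\<close>, which is the source of the factor 2.\<close>
    ultimately have "norm (l - l0) \<le> c * (norm p + norm p)"
      using \<open>c \<ge> 0\<close> norm_fst_le[of v w] norm_snd_le[of w v] unfolding p
      by (smt (verit) mult_left_mono)
    then show ?thesis
      by (simp add: zero_prod_def[symmetric])
  qed
  moreover have "((0, 0), l0) \<in> gph (multiplier_map f Phi Theta x)"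
    using M by (simp add: gph_def multiplier_map_zero)
  moreover have "2 * c \<ge> 0"
    using \<open>c \<ge> 0\<close> by simp
  ultimately show ?thesis
    unfolding isolatedly_calm_at_iff using \<open>\<epsilon> > 0\<close> by blast
qed

text \<open>Every \<open>z\<close> in the inverse normal cone of \<open>l\<close> makes
  \<open>l\<close> a value at the perturbation \<open>(Psi f Phi x l, z - Phi x)\<close>. Calmness
  there, followed by the infimum over \<open>z\<close>, gives the bound.\<close>

lemma isolatedly_calm_imp_error_bound:
  assumes "isolatedly_calm_at (multiplier_map f Phi Theta x) (0, 0) l0"
  obtains c \<epsilon> where "c \<ge> 0" "\<epsilon> > 0"
    "\<And>l. l \<in> cball l0 \<epsilon> \<Longrightarrow>
      ereal (norm (l - l0)) \<le> ereal c * (ereal (norm (Psi f Phi x l))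
        + edist_set (Phi x) (inverse_normal_cone Theta l))"
proof -
  from assms obtain c \<epsilon> where "c \<ge> 0" "\<epsilon> > 0"
    and calm: "\<And>p l. p \<in> ball (0, 0) \<epsilon> \<Longrightarrow> l \<in> multiplier_map f Phi Theta x p \<inter> ball l0 \<epsilon> \<Longrightarrow>
      norm (l - l0) \<le> c * norm (p - (0, 0))"
    unfolding isolatedly_calm_at_iff by blast
  \<comment> \<open>The constant \<open>c + 1\<close> dominates both \<open>c\<close>, needed for
    small perturbations, and 1, needed for large ones, where
    \<open>norm (l - l0) \<le> \<epsilon> / 2\<close> is already smaller than
    \<open>norm p\<close>.\<close>
  have real_bound: "norm (l - l0) \<le> (c + 1) * (norm (Psi f Phi x l) + dist (Phi x) z)"
    if l: "l \<in> cball l0 (\<epsilon> / 2)" and z: "z \<in> inverse_normal_cone Theta l" for l z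
  proof -
    define p where "p = (Psi f Phi x l, z - Phi x)"
    have np: "norm p \<le> norm (Psi f Phi x l) + dist (Phi x) z"
      using norm_Pair_le[of "Psi f Phi x l" "z - Phi x"] by (simp add: p_def dist_norm norm_minus_commute)
    have "norm (l - l0) \<le> (c + 1) * norm p"
    proof (cases "norm p < \<epsilon>")
      case True
      have "l \<in> multiplier_map f Phi Theta x p \<inter> ball l0 \<epsilon>"
        using l z \<open>\<epsilon> > 0\<close> by (auto simp: p_def multiplier_map_def inverse_normal_cone_def)
      then have "norm (l - l0) \<le> c * norm p"
        using calm[of p l] True by (simp add: zero_prod_def[symmetric] dist_norm)
      then show ?thesis
        using norm_ge_zero[of p] by (simp add: algebra_simps del: norm_ge_zero)
    next
      case False
      have "norm (l - l0) \<le> norm p"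
        using l False \<open>\<epsilon> > 0\<close> by (simp add: dist_norm norm_minus_commute)
      also have "\<dots> \<le> (c + 1) * norm p"
        using \<open>c \<ge> 0\<close> by (simp add: algebra_simps)
      finally show ?thesis .
    qed
    also have "\<dots> \<le> (c + 1) * (norm (Psi f Phi x l) + dist (Phi x) z)"
      using np \<open>c \<ge> 0\<close> by (intro mult_left_mono) auto
    finally show ?thesis .
  qed
  show ?thesis
  proof (rule that[of "c + 1" "\<epsilon> / 2"])
    fix l assume l: "l \<in> cball l0 (\<epsilon> / 2)"
    let ?S = "inverse_normal_cone Theta l"
    show "ereal (norm (l - l0)) \<le> ereal (c + 1) * (ereal (norm (Psi f Phi x l)) + edist_set (Phi x) ?S)"
    proof (cases "?S = {}")
      \<comment> \<open>The distance is infinite, and so is the right-hand side because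
        \<open>c + 1\<close> is positive; a factor 0 would give 0.\<close>
      case True
      then show ?thesis
        using \<open>c \<ge> 0\<close> by (simp add: edist_set_def)
    next
      case False
      \<comment> \<open>Solving \<open>real_bound\<close> for the distance to \<open>z\<close> gives
        a lower bound independent of \<open>z\<close>, hence one for the infimum.\<close>
      have "norm (l - l0) / (c + 1) - norm (Psi f Phi x l) \<le> infdist (Phi x) ?S"
        unfolding infdist_notempty[OF False]
      proof (rule cINF_greatest[OF False])
        fix z assume "z \<in> ?S"
        from real_bound[OF l this] \<open>c \<ge> 0\<close>
        show "norm (l - l0) / (c + 1) - norm (Psi f Phi x l) \<le> dist (Phi x) z"
          by (simp add: field_simps)
      qed
      then have "norm (l - l0) \<le> (c + 1) * (norm (Psi f Phi x l) + infdist (Phi x) ?S)"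
        using \<open>c \<ge> 0\<close> by (simp add: field_simps)
      then show ?thesis
        using False by (simp add: edist_set_def)
    qed
  qed (use \<open>c \<ge> 0\<close> \<open>\<epsilon> > 0\<close> in auto)
qed

theorem theorem4p1:
  fixes f :: "'a::euclidean_space \<Rightarrow> 'a"
    and Phi :: "'a \<Rightarrow> 'b::euclidean_space"
    and Theta :: "'b set"
    and xbar :: 'a
    and lbar :: 'b
  assumes "\<forall>x. f differentiable (at x)"
    and "twice_differentiable Phi"
    and "closed Theta"
    and "Phi xbar \<in> Theta"
    and "0 \<in> {f xbar + v | v. v \<in> subdifferential (indicator_fun Theta \<circ> Phi) xbar}"
    and "normally_regular Theta (Phi xbar)"
    and "lbar \<in> multipliers f Phi Theta xbar"
  shows
    "((multipliers f Phi Theta xbar = {lbar} \<and>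
       (\<exists>c\<ge>0. \<exists>\<epsilon>>0. \<forall>l\<in>cball lbar \<epsilon>.
          edist_set l (multipliers f Phi Theta xbar)
            \<le> ereal c * (ereal (norm (Psi f Phi xbar l))
                         + edist_set (Phi xbar) (inverse_normal_cone Theta l))))
      \<longleftrightarrow> (multipliers f Phi Theta xbar = {lbar} \<and>
            calm_at (multiplier_map f Phi Theta xbar) (0, 0) lbar))
     \<and> ((multipliers f Phi Theta xbar = {lbar} \<and>
            calm_at (multiplier_map f Phi Theta xbar) (0, 0) lbar)
      \<longleftrightarrow> isolatedly_calm_at (multiplier_map f Phi Theta xbar) (0, 0) lbar)
     \<and> (isolatedly_calm_at (multiplier_map f Phi Theta xbar) (0, 0) lbar
      \<longleftrightarrow> graphical_derivative (normal_cone Theta) (Phi xbar) lbar 0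
            \<inter> {l. adj_deriv Phi xbar l = 0} = {0})"
proof -
  let ?M = "multiplier_map f Phi Theta xbar" and ?L = "multipliers f Phi Theta xbar"
  \<comment> \<open>\<open>frechet_derivative\<close> is a choice term; differentiability ensures
    that it is the actual, linear derivative.\<close>
  from assms(2) have "Phi differentiable (at xbar)"
    unfolding twice_differentiable_def differentiable_def by blast
  then have lin: "linear (adj_deriv Phi xbar)"
    unfolding adj_deriv_def by (intro adjoint_linear linear_frechet_derivative)
  have gph: "((0, 0), lbar) \<in> gph ?M"
    using assms(7) by (simp add: gph_def multiplier_map_zero)
  \<comment> \<open>The value of \<open>?M\<close> at the origin is the convex multiplier set, so
    (iii) supplies the uniqueness that (i) and (ii) demand.\<close>
  have unique: "?L = {lbar}" if "isolatedly_calm_at ?M (0, 0) lbar"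
    using isolatedly_calm_at_convex_value[OF that] convex_multipliers[OF lin assms(6)]
    by (simp add: multiplier_map_zero)
  have edist: "edist_set l {lbar} = ereal (norm (l - lbar))" for l
    by (simp add: edist_set_def dist_norm)
  have i_iff_iii: "(?L = {lbar} \<and> (\<exists>c\<ge>0. \<exists>\<epsilon>>0. \<forall>l\<in>cball lbar \<epsilon>.
      edist_set l ?L \<le> ereal c * (ereal (norm (Psi f Phi xbar l))
        + edist_set (Phi xbar) (inverse_normal_cone Theta l))))
    \<longleftrightarrow> isolatedly_calm_at ?M (0, 0) lbar" (is "?i \<longleftrightarrow> ?iii")
  proof
    assume ?i
    then have L: "?L = {lbar}"
      by blast
    from \<open>?i\<close> obtain c \<epsilon> where "c \<ge> 0" "\<epsilon> > 0" "\<And>l. l \<in> cball lbar \<epsilon> \<Longrightarrow>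
      ereal (norm (l - lbar)) \<le> ereal c * (ereal (norm (Psi f Phi xbar l))
        + edist_set (Phi xbar) (inverse_normal_cone Theta l))"
      unfolding L edist by blast
    then show ?iii
      using error_bound_imp_isolatedly_calm[OF assms(7)] by blast
  next
    assume ?iii
    then obtain c \<epsilon> where "c \<ge> 0" "\<epsilon> > 0" "\<And>l. l \<in> cball lbar \<epsilon> \<Longrightarrow>
      ereal (norm (l - lbar)) \<le> ereal c * (ereal (norm (Psi f Phi xbar l))
        + edist_set (Phi xbar) (inverse_normal_cone Theta l))"
      using isolatedly_calm_imp_error_bound by blast
    then show ?i
      unfolding unique[OF \<open>?iii\<close>] edist by blast
  qed
  \<comment> \<open>Either side forces \<open>?L = {lbar}\<close>, and for a singleton value at the
    origin calmness and isolated calmness are the same condition.\<close>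
  have ii_iff_iii: "(?L = {lbar} \<and> calm_at ?M (0, 0) lbar) \<longleftrightarrow> isolatedly_calm_at ?M (0, 0) lbar"
    using unique calm_at_iff_isolatedly_calm_at[of ?M "(0, 0)" lbar]
    unfolding multiplier_map_zero by blast
  have "Psi f Phi xbar lbar = 0"
    using assms(7) by (simp add: multipliers_def)
  from graphical_derivative_multiplier_map[OF lin this]
  have "graphical_derivative ?M (0, 0) lbar 0 =
    graphical_derivative (normal_cone Theta) (Phi xbar) lbar 0 \<inter> {l. adj_deriv Phi xbar l = 0}"
    by (simp add: zero_prod_def)
  then have iii_iff_iv: "isolatedly_calm_at ?M (0, 0) lbar \<longleftrightarrow>
    graphical_derivative (normal_cone Theta) (Phi xbar) lbar 0 \<inter> {l. adj_deriv Phi xbar l = 0} = {0}"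
    using isolatedly_calm_at_imp_graphical_derivative[of ?M "(0, 0)" lbar]
      graphical_derivative_imp_isolatedly_calm_at[OF gph] by auto
  show ?thesis
    using i_iff_iii ii_iff_iii iii_iff_iv by blast
qed

end
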